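(* Let $m,\ell$ be positive integers and $r\ge1$. Let $X$ be an $n$-dimensional $C^r$ manifold with $\ell>2n$, let $V$ be an open subset of $\mathbb{R}^m$, let $f:X\to V$ be an injective $C^r$ mapping, and let $g:V\to\mathbb{R}^\ell$ be a $C^r$ mapping. Set $$\Sigma=\{\pi\in\mathcal{L}(\mathbb{R}^m,\mathbb{R}^\ell)\mid (g+\pi)\circ f:X\to\mathbb{R}^\ell \text{ is not injective}\}.$$ Then, for any real number $s$ satisfying $$s>m\ell+2n-\ell,$$ the set $\Sigma$ has $s$-dimensional Hausdorff measure zero in $\mathcal{L}(\mathbb{R}^m,\mathbb{R}^\ell)$.
   Context: All manifolds are without boundary and second countable; the differentiability class $r$ is a positive integer or $\infty$. $\mathcal{L}(\mathbb{R}^m,\mathbb{R}^\ell)$ is the space of all linear mappings $\mathbb{R}^m\to\mathbb{R}^\ell$, identified with the Euclidean space $(\mathbb{R}^m)^\ell=\mathbb{R}^{m\ell}$ via matrix entries. In $g+\pi$, the linear map $\pi$ is restricted to $V$. For $s>0$, the $s$-dimensional Hausdorff outer measure of $B\subset\mathbb{R}^N$ is $\lim_{\delta\to0}\inf\{\sum_{j=1}^\infty(\operatorname{diam}C_j)^s\mid B\subset\bigcup_{j=1}^\infty C_j,\ \operatorname{diam}C_j\le\delta\}$ (Euclidean diameter, arbitrary subsets $C_j$ of $\mathbb{R}^N$); for $s=0$ it is the counting measure. A subset of $\mathcal{L}(\mathbb{R}^m,\mathbb{R}^\ell)$ has $s$-dimensional Hausdorff measure zero if its $s$-dimensional Hausdorff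 outer measure in $\mathbb{R}^{m\ell}$ is zero. *)

theory Defs
  imports "HOL-Analysis.Analysis" "HOL-Library.Extended_Nat"
begin

section \<open>Differentiability classes in coordinates\<close>

text \<open>
  A function of finitely many real variables, indexed by \<open>I\<close>, is given on coordinate tuples
  \<open>x :: 'i \<Rightarrow> real\<close>. For \<open>I = {..<n}\<close> the tuples are those of \<^const>\<open>Euclidean_space\<close> \<open>n\<close>
  (zero outside \<open>I\<close>), which also covers \<open>n = 0\<close>. In \<open>Ck_on I k S h\<close> the set \<open>S\<close> is meant to be
  open in the space of these tuples. The topology on tuples is the product topology.
\<close>

primrec Ck_on ::
  "'i set \<Rightarrow> nat \<Rightarrow> ('i \<Rightarrow> real) set \<Rightarrow> (('i \<Rightarrow> real) \<Rightarrow> 'b::real_normed_vector) \<Rightarrow> bool"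
where
  "Ck_on I 0 S h \<longleftrightarrow> continuous_on S h"
| "Ck_on I (Suc k) S h \<longleftrightarrow> continuous_on S h \<and>
     (\<forall>i\<in>I. \<exists>D. (\<forall>x\<in>S. ((\<lambda>t. h (x(i := t))) has_vector_derivative D x) (at (x i)))
                \<and> Ck_on I k S D)"

definition Cr_on ::
  "'i set \<Rightarrow> enat \<Rightarrow> ('i \<Rightarrow> real) set \<Rightarrow> (('i \<Rightarrow> real) \<Rightarrow> 'b::real_normed_vector) \<Rightarrow> bool"
where
  "Cr_on I r S h \<longleftrightarrow> (\<forall>k::nat. enat k \<le> r \<longrightarrow> Ck_on I k S h)"

definition Cr_on_vec ::
  "enat \<Rightarrow> (real^'m) set \<Rightarrow> (real^'m \<Rightarrow> 'b::real_normed_vector) \<Rightarrow> bool"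
where
  "Cr_on_vec r V g \<longleftrightarrow> Cr_on UNIV r (vec_nth ` V) (\<lambda>x. g (vec_lambda x))"

section \<open>Manifolds\<close>

definition second_countable_space :: "'a topology \<Rightarrow> bool" where
  "second_countable_space X \<longleftrightarrow>
     (\<exists>\<B>. countable \<B> \<and> (\<forall>B\<in>\<B>. openin X B) \<and>
          (\<forall>U. openin X U \<longrightarrow> (\<exists>\<U>\<subseteq>\<B>. U = \<Union>\<U>)))"

definition chart_on :: "nat \<Rightarrow> 'a topology \<Rightarrow> 'a set \<Rightarrow> ('a \<Rightarrow> nat \<Rightarrow> real) \<Rightarrow> bool" where
  "chart_on n X U \<phi> \<longleftrightarrow> openin X U \<and> openin (Euclidean_space n) (\<phi> ` U) \<and>
     homeomorphic_map (subtopology X U) (subtopology (Euclidean_space n) (\<phi> ` U)) \<phi>"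

text \<open>
  The differentiable structure is given by a \<open>C\<^sup>r\<close> atlas, not necessarily maximal; a mapping is
  \<open>C\<^sup>r\<close> with respect to an atlas iff it is so with respect to the maximal atlas containing it.
\<close>

definition Cr_manifold ::
  "enat \<Rightarrow> nat \<Rightarrow> 'a topology \<Rightarrow> ('a set \<times> ('a \<Rightarrow> nat \<Rightarrow> real)) set \<Rightarrow> bool"
where
  "Cr_manifold r n X \<A> \<longleftrightarrow>
     Hausdorff_space X \<and> second_countable_space X \<and>
     (\<forall>(U, \<phi>)\<in>\<A>. chart_on n X U \<phi>) \<and>
     (\<Union>(U, \<phi>)\<in>\<A>. U) = topspace X \<and>
     (\<forall>(U, \<phi>)\<in>\<A>. \<forall>(W, \<psi>)\<in>\<A>. \<forall>j<n.
        Cr_on {..<n} r (\<phi> ` (U \<inter> W)) (\<lambda>x. \<psi> (inv_into U \<phi> x) j))"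

definition Cr_map ::
  "enat \<Rightarrow> nat \<Rightarrow> ('a set \<times> ('a \<Rightarrow> nat \<Rightarrow> real)) set \<Rightarrow> ('a \<Rightarrow> 'b::real_normed_vector) \<Rightarrow> bool"
where
  "Cr_map r n \<A> f \<longleftrightarrow>
     (\<forall>(U, \<phi>)\<in>\<A>. Cr_on {..<n} r (\<phi> ` U) (\<lambda>x. f (inv_into U \<phi> x)))"

section \<open>Hausdorff measure\<close>

text \<open>
  \<^const>\<open>diameter\<close> is unspecified on unbounded sets, so boundedness is required explicitly.
\<close>

definition hausdorff_premeasure :: "real \<Rightarrow> real \<Rightarrow> 'a::euclidean_space set \<Rightarrow> ennreal" where
  "hausdorff_premeasure s \<delta> B =
     Inf {(\<Sum>j. ennreal (diameter (C j) powr s)) | C :: nat \<Rightarrow> 'a set.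
            B \<subseteq> (\<Union>j. C j) \<and> (\<forall>j. bounded (C j) \<and> diameter (C j) \<le> \<delta>)}"

definition hausdorff_outer_measure :: "real \<Rightarrow> 'a::euclidean_space set \<Rightarrow> ennreal" where
  "hausdorff_outer_measure s B =
     (if s = 0 then emeasure (count_space UNIV) B
      else Lim (at_right 0) (\<lambda>\<delta>. hausdorff_premeasure s \<delta> B))"

text \<open>The limit always exists, by monotonicity in \<open>\<delta>\<close>.\<close>

lemma hausdorff_premeasure_antimono:
  "\<delta> \<le> \<epsilon> \<Longrightarrow> hausdorff_premeasure s \<epsilon> B \<le> hausdorff_premeasure s \<delta> B"
  unfolding hausdorff_premeasure_def by (rule Inf_superset_mono) (auto intro: order_trans)

lemma tendsto_hausdorff_premeasure:
  "((\<lambda>\<delta>. hausdorff_premeasure s \<delta> B) \<longlongrightarrow> (SUP \<delta>\<in>{0<..}. hausdorff_premeasure s \<delta> B)) (at_right 0)"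
proof (rule order_tendstoI)
  fix a assume "a < (SUP \<delta>\<in>{0<..}. hausdorff_premeasure s \<delta> B)"
  then obtain d where d: "d > 0" "a < hausdorff_premeasure s d B"
    by (auto simp: less_SUP_iff)
  then show "\<forall>\<^sub>F \<delta> in at_right 0. a < hausdorff_premeasure s \<delta> B"
    unfolding eventually_at_right_field
    by (meson hausdorff_premeasure_antimono less_le_trans less_imp_le)
next
  fix a assume a: "(SUP \<delta>\<in>{0<..}. hausdorff_premeasure s \<delta> B) < a"
  have "hausdorff_premeasure s \<delta> B < a" if "\<delta> > 0" for \<delta>
    using a that by (meson SUP_lessD greaterThan_iff)
  then show "\<forall>\<^sub>F \<delta> in at_right 0. hausdorff_premeasure s \<delta> B < a"
    unfolding eventually_at_right_field by (auto intro: exI[of _ 1])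
qed

lemma hausdorff_outer_measure_eq_SUP:
  "s \<noteq> 0 \<Longrightarrow> hausdorff_outer_measure s B = (SUP \<delta>\<in>{0<..}. hausdorff_premeasure s \<delta> B)"
  unfolding hausdorff_outer_measure_def
  by (simp add: tendsto_Lim[OF _ tendsto_hausdorff_premeasure])

text \<open>
  Linear mappings are identified with their matrices; the norm of \<^typ>\<open>real^'m^'l\<close> is the Euclidean
  norm of the matrix entries.
\<close>

definition hausdorff_null_linear_maps ::
  "real \<Rightarrow> (real^'m \<Rightarrow> real^'l) set \<Rightarrow> bool"
where
  "hausdorff_null_linear_maps s L \<longleftrightarrow> hausdorff_outer_measure s (matrix ` L) = 0"

end

theory Submission
  imports Defs
begin

text \<open>
  If \<open>(g + \<pi>) \<circ> f\<close> identifies two points \<open>x \<noteq> y\<close>, then \<open>A v = g (f y) - g (f x)\<close>, where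
  \<open>A\<close> is the matrix of \<open>\<pi>\<close> and \<open>v = f x - f y\<close>; injectivity of \<open>f\<close> makes \<open>v\<close> nonzero. Say
  \<open>v\<^sub>i \<noteq> 0\<close>. Then column \<open>i\<close> of \<open>A\<close> can be solved for: it is determined by \<open>x\<close>, \<open>y\<close> and the
  other columns. So the matrices in question depend on only \<open>2 n + \<ell> (m - 1)\<close> real
  parameters, namely the chart coordinates of the two points and the entries off column \<open>i\<close>, and
  this number is exactly \<open>m \<ell> + 2 n - \<ell>\<close>, the bound that \<open>s\<close> exceeds.

  To turn this count into a statement on Hausdorff measure, the dependence on the parameters must be
  Lipschitz. Near every point of the manifold both \<open>f\<close> and \<open>g \<circ> f\<close> are Lipschitz functions of
  chart coordinates, because continuously differentiable maps are locally Lipschitz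
  (\<open>C1_locally_lipschitz\<close>, \<open>lipschitz_chart_neighbourhood\<close>). By the Lindelof property countably
  many such neighbourhoods suffice, and a further countable subdivision bounds the entries of
  \<open>A\<close> and \<open>v\<close> from above and \<open>\<bar>v\<^sub>i\<bar>\<close> from below. On one of these countably many pieces two
  matrices with parameters at distance at most \<open>d\<close> differ by \<open>O(d)\<close>
  (\<open>matrix_column_lipschitz\<close>). Cutting the \<open>D\<close>-dimensional cube of parameters into
  \<open>N ^ D\<close> equal cells then covers the piece by \<open>N ^ D\<close> sets of diameter \<open>O(1/N)\<close>, whose
  diameters to the power \<open>s\<close> add up to \<open>O(N powr (D - s))\<close>, which tends to zero for \<open>s > D\<close>
  (\<open>hausdorff_null_if_lipschitz_in_coords\<close>).
\<close>

section \<open>Sets of Hausdorff measure zero\<close>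

text \<open>
  For \<open>s > 0\<close> the bound \<open>\<delta>\<close> on the diameters may be dropped when only nullity matters: if the sum of
  the \<open>s\<close>-th powers of the diameters is below \<open>\<delta> powr s\<close>, then so is each term, hence each
  diameter is below \<open>\<delta>\<close>.
\<close>

lemma hausdorff_null_iff_small_covers:
  fixes B :: "'a::euclidean_space set"
  assumes s: "s > 0"
  shows "hausdorff_outer_measure s B = 0 \<longleftrightarrow>
    (\<forall>\<epsilon>>0. \<exists>C :: nat \<Rightarrow> 'a set. B \<subseteq> (\<Union>j. C j) \<and> (\<forall>j. bounded (C j)) \<and>
       (\<Sum>j. ennreal (diameter (C j) powr s)) < ennreal \<epsilon>)" (is "?L \<longleftrightarrow> ?R")
proof
  assume L: ?L
  show ?R
  proof (intro allI impI)
    fix \<epsilon> :: real assume "\<epsilon> > 0"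
    have "hausdorff_premeasure s 1 B \<le> (SUP \<delta>\<in>{0<..}. hausdorff_premeasure s \<delta> B)"
      by (rule SUP_upper) simp
    then have "hausdorff_premeasure s 1 B = 0"
      using L s by (simp add: hausdorff_outer_measure_eq_SUP)
    then have "hausdorff_premeasure s 1 B < ennreal \<epsilon>" using \<open>\<epsilon> > 0\<close> by simp
    then show "\<exists>C :: nat \<Rightarrow> 'a set. B \<subseteq> (\<Union>j. C j) \<and> (\<forall>j. bounded (C j)) \<and>
       (\<Sum>j. ennreal (diameter (C j) powr s)) < ennreal \<epsilon>"
      unfolding hausdorff_premeasure_def Inf_less_iff by blast
  qed
next
  assume R: ?R
  have small: "hausdorff_premeasure s \<delta> B \<le> ennreal e" if "\<delta> > 0" "e > 0" for \<delta> e
  proof -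
    have "min e (\<delta> powr s) > 0" using that by simp
    then obtain C :: "nat \<Rightarrow> 'a set" where C: "B \<subseteq> (\<Union>j. C j)" "\<And>j. bounded (C j)"
      and sum: "(\<Sum>j. ennreal (diameter (C j) powr s)) < ennreal (min e (\<delta> powr s))"
      using R by blast
    have "diameter (C j) \<le> \<delta>" for j
    proof -
      have "ennreal (diameter (C j) powr s) < ennreal (min e (\<delta> powr s))"
        by (rule ennreal_suminf_lessD[OF sum])
      also have "\<dots> \<le> ennreal (\<delta> powr s)" by (intro ennreal_leI) simp
      finally have "ennreal (diameter (C j) powr s) < ennreal (\<delta> powr s)" .
      then have less: "diameter (C j) powr s < \<delta> powr s"
        by (subst (asm) ennreal_less_iff) simp_all
      show ?thesis
      proof (rule ccontr)
        assume "\<not> diameter (C j) \<le> \<delta>"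
        then have "\<delta> powr s \<le> diameter (C j) powr s"
          using s that by (intro powr_mono2) auto
        then show False using less by simp
      qed
    qed
    then have "hausdorff_premeasure s \<delta> B \<le> (\<Sum>j. ennreal (diameter (C j) powr s))"
      unfolding hausdorff_premeasure_def using C by (intro Inf_lower) auto
    also have "\<dots> \<le> ennreal (min e (\<delta> powr s))" using sum by (rule less_imp_le)
    also have "\<dots> \<le> ennreal e" by (intro ennreal_leI) simp
    finally show ?thesis .
  qed
  have "hausdorff_premeasure s \<delta> B \<le> 0" if "\<delta> > 0" for \<delta>
    by (rule ennreal_le_epsilon) (simp add: that small)
  then show ?L using s by (simp add: hausdorff_outer_measure_eq_SUP SUP_eq_iff bot_ennreal)
qed

lemma hausdorff_null_subset:
  fixes A B :: "'a::euclidean_space set"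
  assumes "s > 0" "hausdorff_outer_measure s B = 0" "A \<subseteq> B"
  shows "hausdorff_outer_measure s A = 0"
  unfolding hausdorff_null_iff_small_covers[OF assms(1)]
proof (intro allI impI)
  fix \<epsilon> :: real assume "\<epsilon> > 0"
  with assms(2) have "\<exists>C :: nat \<Rightarrow> 'a set. B \<subseteq> (\<Union>j. C j) \<and> (\<forall>j. bounded (C j)) \<and>
       (\<Sum>j. ennreal (diameter (C j) powr s)) < ennreal \<epsilon>"
    unfolding hausdorff_null_iff_small_covers[OF assms(1)] by simp
  then show "\<exists>C :: nat \<Rightarrow> 'a set. A \<subseteq> (\<Union>j. C j) \<and> (\<forall>j. bounded (C j)) \<and>
       (\<Sum>j. ennreal (diameter (C j) powr s)) < ennreal \<epsilon>"
    by (elim ex_forward conj_forward order_trans[OF assms(3)])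
qed

text \<open>
  The usual argument: cover the \<open>k\<close>-th set with total cost less than \<open>\<epsilon> / 2 ^ (k + 2)\<close> and
  merge the covers along \<^const>\<open>prod_decode\<close>.
\<close>

lemma hausdorff_null_UN_nat:
  fixes B :: "nat \<Rightarrow> 'a::euclidean_space set"
  assumes s: "s > 0" and null: "\<And>k. hausdorff_outer_measure s (B k) = 0"
  shows "hausdorff_outer_measure s (\<Union>k. B k) = 0"
  unfolding hausdorff_null_iff_small_covers[OF s]
proof (intro allI impI)
  fix \<epsilon> :: real assume e: "\<epsilon> > 0"
  have "\<forall>k. \<exists>C :: nat \<Rightarrow> 'a set. B k \<subseteq> (\<Union>j. C j) \<and> (\<forall>j. bounded (C j)) \<and>
       (\<Sum>j. ennreal (diameter (C j) powr s)) < ennreal ((\<epsilon>/2) * (1/2)^Suc k)"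
    using null e unfolding hausdorff_null_iff_small_covers[OF s] by simp
  then obtain C :: "nat \<Rightarrow> nat \<Rightarrow> 'a set" where C: "\<And>k. B k \<subseteq> (\<Union>j. C k j)" "\<And>k j. bounded (C k j)"
    and sum: "\<And>k. (\<Sum>j. ennreal (diameter (C k j) powr s)) < ennreal ((\<epsilon>/2) * (1/2)^Suc k)"
    by metis
  let ?E = "\<lambda>i. case_prod C (prod_decode i)"
  have "(\<Sum>i. ennreal (diameter (?E i) powr s))
      = (\<Sum>i. (\<lambda>(k,j). ennreal (diameter (C k j) powr s)) (prod_decode i))"
    by (simp add: case_prod_beta)
  also have "\<dots> = (\<Sum>k. \<Sum>j. ennreal (diameter (C k j) powr s))"
    by (rule suminf_ennreal_2dimen) auto
  also have "\<dots> \<le> (\<Sum>k. ennreal ((\<epsilon>/2) * (1/2)^Suc k))"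
    using sum by (intro suminf_le) (auto intro: less_imp_le)
  also have "\<dots> = ennreal (\<Sum>k. (\<epsilon>/2) * (1/2)^Suc k)"
    using e by (intro suminf_ennreal2) (auto intro!: summable_mult simp: summable_geometric)
  also have "\<dots> = ennreal (\<epsilon>/2)"
    using sums_unique[OF sums_mult[OF power_half_series, of "\<epsilon>/2"]] by (simp only: mult_1_right)
  also have "\<dots> < ennreal \<epsilon>" using e by (simp add: ennreal_less_iff)
  finally have small: "(\<Sum>i. ennreal (diameter (?E i) powr s)) < ennreal \<epsilon>" .
  have "(\<Union>k. B k) \<subseteq> (\<Union>i. ?E i)"
  proof
    fix x assume "x \<in> (\<Union>k. B k)"
    then obtain k where "x \<in> B k" by blast
    then obtain j where "x \<in> C k j" using C(1)[of k] by blast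
    then have "x \<in> ?E (prod_encode (k,j))" by simp
    then show "x \<in> (\<Union>i. ?E i)" by (rule UN_I[OF UNIV_I])
  qed
  moreover have "\<forall>i. bounded (?E i)" using C(2) by (simp add: case_prod_beta)
  ultimately show "\<exists>D :: nat \<Rightarrow> 'a set. (\<Union>k. B k) \<subseteq> (\<Union>j. D j) \<and> (\<forall>j. bounded (D j)) \<and>
       (\<Sum>j. ennreal (diameter (D j) powr s)) < ennreal \<epsilon>"
    using small by (intro exI[of _ ?E] conjI)
qed

lemma hausdorff_null_Union:
  fixes \<B> :: "'a::euclidean_space set set"
  assumes s: "s > 0" and "countable \<B>"
    and null: "\<And>B. B \<in> \<B> \<Longrightarrow> hausdorff_outer_measure s B = 0"
  shows "hausdorff_outer_measure s (\<Union>\<B>) = 0"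
proof -
  have empty: "hausdorff_outer_measure s ({} :: 'a set) = 0"
    unfolding hausdorff_null_iff_small_covers[OF s]
    using s by (intro allI impI exI[of _ "\<lambda>_. {}"]) simp
  \<comment> \<open>The empty set is added so that an enumeration exists even when \<open>\<B>\<close> is empty.\<close>
  define F where "F = from_nat_into (insert {} \<B>)"
  have rng: "range F = insert {} \<B>"
    unfolding F_def using assms(2) by (intro range_from_nat_into) auto
  have "F k \<in> insert {} \<B>" for k using rng by blast
  then have "hausdorff_outer_measure s (F k) = 0" for k
    using null empty by (metis insertE)
  then have "hausdorff_outer_measure s (\<Union>(range F)) = 0"
    using hausdorff_null_UN_nat[OF s, of F] by simp
  then show ?thesis unfolding rng by simp
qed

lemma hausdorff_null_if_small_finite_covers:
  fixes B :: "'a::euclidean_space set"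
  assumes s: "s > 0"
    and cover: "\<And>\<epsilon>. \<epsilon> > 0 \<Longrightarrow> \<exists>(J::'j set) C. finite J \<and> B \<subseteq> (\<Union>j\<in>J. C j) \<and>
        (\<forall>j\<in>J. bounded (C j)) \<and> (\<Sum>j\<in>J. diameter (C j) powr s) < \<epsilon>"
  shows "hausdorff_outer_measure s B = 0"
  unfolding hausdorff_null_iff_small_covers[OF s]
proof (intro allI impI)
  fix \<epsilon> :: real assume "\<epsilon> > 0"
  from cover[OF this] obtain J :: "'j set" and C where J: "finite J" "B \<subseteq> (\<Union>j\<in>J. C j)"
    "\<forall>j\<in>J. bounded (C j)" "(\<Sum>j\<in>J. diameter (C j) powr s) < \<epsilon>"
    by (elim exE conjE)
  obtain e where e: "bij_betw e {..<card J} J"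
    using ex_bij_betw_nat_finite[OF J(1)] by (auto simp: atLeast0LessThan)
  define D where "D i = (if i < card J then C (e i) else {})" for i
  have eJ: "e i \<in> J" if "i < card J" for i using e that by (auto simp: bij_betw_def)
  have "(\<Union>j\<in>J. C j) = (\<Union>i<card J. C (e i))"
    using e by (metis bij_betw_imp_surj_on image_image)
  then have "B \<subseteq> (\<Union>i. D i)" using J(2) by (auto simp: D_def)
  moreover have "\<forall>i. bounded (D i)" using J(3) eJ by (simp add: D_def)
  moreover have "(\<Sum>i. ennreal (diameter (D i) powr s)) < ennreal \<epsilon>"
  proof -
    have "(\<Sum>i. ennreal (diameter (D i) powr s)) = (\<Sum>i<card J. ennreal (diameter (D i) powr s))"
      using s by (intro suminf_finite) (auto simp: D_def)
    also have "\<dots> = ennreal (\<Sum>i<card J. diameter (C (e i)) powr s)"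
      by (simp add: D_def)
    also have "(\<Sum>i<card J. diameter (C (e i)) powr s) = (\<Sum>j\<in>J. diameter (C j) powr s)"
      by (rule sum.reindex_bij_betw[OF e])
    finally show ?thesis using J(4) by (simp add: ennreal_less_iff sum_nonneg)
  qed
  ultimately show "\<exists>C :: nat \<Rightarrow> 'a set. B \<subseteq> (\<Union>j. C j) \<and> (\<forall>j. bounded (C j)) \<and>
       (\<Sum>j. ennreal (diameter (C j) powr s)) < ennreal \<epsilon>"
    by (intro exI[of _ D] conjI)
qed

section \<open>Lipschitz dependence on finitely many bounded coordinates\<close>

text \<open>
  Distances in the domain are measured only through the coordinates \<open>c\<close>, in the supremum norm. Thus
  the notion applies to points of a manifold with chart coordinates as well as to matrices with a
  system of parameters. The supremum is replaced by an arbitrary upper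
  bound \<open>d \<ge> 0\<close>, which makes sense for empty \<open>I\<close> too: then \<open>u\<close> is constant on \<open>N\<close>, as
  \<open>d = 0\<close> shows.
\<close>

definition lipschitz_in_coords ::
  "'i set \<Rightarrow> ('a \<Rightarrow> 'i \<Rightarrow> real) \<Rightarrow> 'a set \<Rightarrow> real \<Rightarrow> ('a \<Rightarrow> 'b::real_normed_vector) \<Rightarrow> bool"
where
  "lipschitz_in_coords I c N L u \<longleftrightarrow>
     (\<forall>x\<in>N. \<forall>y\<in>N. \<forall>d\<ge>0. (\<forall>i\<in>I. \<bar>c x i - c y i\<bar> \<le> d) \<longrightarrow> norm (u x - u y) \<le> L * d)"

lemma lipschitz_in_coordsD:
  assumes "lipschitz_in_coords I c N L u" "x \<in> N" "y \<in> N" "d \<ge> 0"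
    "\<And>i. i \<in> I \<Longrightarrow> \<bar>c x i - c y i\<bar> \<le> d"
  shows "norm (u x - u y) \<le> L * d"
  using assms(1)[unfolded lipschitz_in_coords_def, rule_format, OF assms(2-4)] assms(5) by simp

text \<open>
  The number \<open>nat \<lfloor>(x + M) * N / (2 * M + 1)\<rfloor>\<close> is the index of the cell containing \<open>x\<close> when
  the interval \<open>[-M, M + 1]\<close> is cut into \<open>N\<close> equal parts. The excess length 1 gives \<open>x = M\<close> an index
  below \<open>N\<close> and keeps the length positive when \<open>M = 0\<close>.
\<close>

lemma floor_cell_bounds:
  fixes x M :: real and N :: nat
  assumes "\<bar>x\<bar> \<le> M" "N > 0"
  shows "nat \<lfloor>(x + M) * N / (2*M+1)\<rfloor> < N"
    "real (nat \<lfloor>(x + M) * N / (2*M+1)\<rfloor>) \<le> (x + M) * N / (2*M+1)"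
    "(x + M) * N / (2*M+1) < real (nat \<lfloor>(x + M) * N / (2*M+1)\<rfloor>) + 1"
proof -
  have M: "M \<ge> 0" using assms by linarith
  have ge: "0 \<le> (x + M) * N / (2*M+1)" using assms M by simp
  have "(x + M) / (2*M+1) < 1" using assms M by (simp add: field_simps)
  then have "(x + M) / (2*M+1) * N < 1 * real N" using assms by (intro mult_strict_right_mono) auto
  then have lt: "(x + M) * N / (2*M+1) < N" by simp
  show "nat \<lfloor>(x + M) * N / (2*M+1)\<rfloor> < N" using ge lt assms by linarith
  show "real (nat \<lfloor>(x + M) * N / (2*M+1)\<rfloor>) \<le> (x + M) * N / (2*M+1)" using ge by linarith
  show "(x + M) * N / (2*M+1) < real (nat \<lfloor>(x + M) * N / (2*M+1)\<rfloor>) + 1" using ge by linarith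
qed

text \<open>
  A bounded set that is Lipschitz parametrised by \<open>D = card I\<close> real numbers is null in every
  dimension \<open>s > D\<close>: with \<open>N\<close> cells in each coordinate direction there are \<open>N ^ D\<close> pieces of diameter
  at most \<open>L (2 M + 1) / N\<close>. The parameters are functions \<open>c\<close> on the set itself,
  the inverse of a parametrisation, and the cells of the cube are pulled back along \<open>c\<close>.
\<close>

lemma hausdorff_null_if_lipschitz_in_coords:
  fixes B :: "'b::euclidean_space set" and c :: "'b \<Rightarrow> 'i \<Rightarrow> real"
  assumes fin: "finite I" and s: "s > real (card I)"
    and bnd: "\<And>b i. b \<in> B \<Longrightarrow> i \<in> I \<Longrightarrow> \<bar>c b i\<bar> \<le> M"
    and lip: "lipschitz_in_coords I c B L (\<lambda>b. b)" and L: "L \<ge> 0" and M: "M \<ge> 0"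
  shows "hausdorff_outer_measure s B = 0"
proof -
  have s0: "s > 0" using s by linarith
  show ?thesis
  proof (rule hausdorff_null_if_small_finite_covers[OF s0])
    fix \<epsilon> :: real assume e: "\<epsilon> > 0"
    let ?K = "L * (2*M+1)" and ?D = "real (card I)"
    have K0: "?K \<ge> 0" using L M by simp
    have "((\<lambda>N. ?K powr s * real N powr (?D - s)) \<longlongrightarrow> 0) sequentially"
      using s by (intro tendsto_mult_right_zero tendsto_neg_powr filterlim_real_sequentially) auto
    then have "\<forall>\<^sub>F N in sequentially. ?K powr s * real N powr (?D - s) < \<epsilon>"
      using e by (rule order_tendstoD)
    then obtain N where N: "N > 0" "?K powr s * real N powr (?D - s) < \<epsilon>"
      using eventually_conj[OF eventually_gt_at_top[of 0]]
      by (smt (verit) eventually_False_sequentially eventually_mono)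
    define idx where "idx b i = nat \<lfloor>(c b i + M) * N / (2*M+1)\<rfloor>" for b i
    define J where "J = (\<Pi>\<^sub>E i\<in>I. {..<N})"
    define C where "C k = {b\<in>B. \<forall>i\<in>I. idx b i = k i}" for k
    have "finite J" using fin by (simp add: J_def finite_PiE)
    moreover have "B \<subseteq> (\<Union>k\<in>J. C k)"
    proof
      fix b assume b: "b \<in> B"
      have "restrict (idx b) I \<in> J"
        unfolding J_def idx_def using floor_cell_bounds(1)[OF bnd[OF b] N(1)] by auto
      moreover have "b \<in> C (restrict (idx b) I)" using b by (simp add: C_def)
      ultimately show "b \<in> (\<Union>k\<in>J. C k)" by blast
    qed
    moreover have near: "norm (x - y) \<le> ?K / N" if "x \<in> C k" "y \<in> C k" for x y k
    proof -
      have "\<bar>c x i - c y i\<bar> \<le> (2*M+1) / N" if i: "i \<in> I" for i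
      proof -
        have xy: "x \<in> B" "y \<in> B" "idx x i = idx y i"
          using \<open>x \<in> C k\<close> \<open>y \<in> C k\<close> i by (auto simp: C_def)
        have "\<bar>(c x i + M) * N / (2*M+1) - (c y i + M) * N / (2*M+1)\<bar> \<le> 1"
          using floor_cell_bounds(2,3)[OF bnd[OF xy(1) i] N(1)]
            floor_cell_bounds(2,3)[OF bnd[OF xy(2) i] N(1)] xy(3)
          unfolding idx_def by linarith
        also have "(c x i + M) * N / (2*M+1) - (c y i + M) * N / (2*M+1)
            = (c x i - c y i) * (N / (2*M+1))"
          by (simp add: diff_divide_distrib[symmetric] algebra_simps)
        finally have "\<bar>c x i - c y i\<bar> * (N / (2*M+1)) \<le> 1"
          using M by (simp add: abs_mult)
        then show ?thesis using N(1) M by (simp add: field_simps)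
      qed
      then have "norm (x - y) \<le> L * ((2*M+1) / N)"
        using that M by (intro lipschitz_in_coordsD[OF lip]) (auto simp: C_def)
      then show ?thesis by simp
    qed
    moreover have "\<forall>k\<in>J. bounded (C k)"
    proof
      fix k
      have "C k \<subseteq> cball y (?K / N)" if "y \<in> C k" for y
        using near[OF that] by (auto simp: dist_norm)
      then show "bounded (C k)" using bounded_cball bounded_subset
        by (metis bounded_empty equals0I)
    qed
    moreover have "(\<Sum>k\<in>J. diameter (C k) powr s) < \<epsilon>"
    proof -
      have "(\<Sum>k\<in>J. diameter (C k) powr s) \<le> (\<Sum>k\<in>J. (?K / N) powr s)"
      proof (intro sum_mono powr_mono2)
        fix k assume "k \<in> J"
        show "0 \<le> diameter (C k)" using calculation(4) \<open>k \<in> J\<close> by (simp add: diameter_ge_0)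
        show "diameter (C k) \<le> ?K / N" using near K0 by (intro diameter_le) auto
      qed (use s0 in auto)
      also have "\<dots> = real N ^ card I * (?K / N) powr s"
        using fin by (simp add: J_def card_PiE)
      also have "\<dots> = ?K powr s * real N powr (?D - s)"
        using K0 N(1) by (simp add: powr_divide powr_diff powr_realpow)
      finally show ?thesis using N(2) by simp
    qed
    ultimately show "\<exists>(J::('i \<Rightarrow> nat) set) C. finite J \<and> B \<subseteq> (\<Union>j\<in>J. C j) \<and>
        (\<forall>j\<in>J. bounded (C j)) \<and> (\<Sum>j\<in>J. diameter (C j) powr s) < \<epsilon>"
      by (intro exI[of _ J] exI[of _ C] conjI)
  qed
qed

section \<open>Continuously differentiable maps are locally Lipschitz\<close>

text \<open>
  A basic neighbourhood in the product topology has its own radius in each of finitely many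
  directions; finiteness of \<open>I\<close> gives a common one.
\<close>

lemma cube_in_open_fun:
  fixes x :: "'i \<Rightarrow> real"
  assumes "open T" "x \<in> T" "finite I"
  obtains e where "e > 0" "\<And>y. \<lbrakk>\<And>i. i \<in> I \<Longrightarrow> \<bar>y i - x i\<bar> < e; \<And>i. i \<notin> I \<Longrightarrow> y i = x i\<rbrakk> \<Longrightarrow> y \<in> T"
proof -
  obtain X where X: "x \<in> Pi\<^sub>E UNIV X" "\<And>i. open (X i)" "Pi\<^sub>E UNIV X \<subseteq> T"
    using product_topology_open_contains_basis[of "\<lambda>i. euclidean" UNIV T x] assms
    by (auto simp: open_fun_def)
  have xX: "x i \<in> X i" for i using X(1) by auto
  have "\<exists>e>0. \<forall>t. \<bar>t - x i\<bar> < e \<longrightarrow> t \<in> X i" for i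
    using X(2)[of i] xX[of i] unfolding open_dist dist_real_def by blast
  then obtain e where e: "\<And>i. e i > 0" "\<And>i t. \<bar>t - x i\<bar> < e i \<Longrightarrow> t \<in> X i" by metis
  \<comment> \<open>The 1 provides a radius when \<open>I\<close> is empty.\<close>
  define e0 where "e0 = Min (insert 1 (e ` I))"
  have "e0 > 0" "\<And>i. i \<in> I \<Longrightarrow> e0 \<le> e i"
    using assms(3) e(1) by (auto simp: e0_def)
  moreover have "y \<in> T"
    if "\<And>i. i \<in> I \<Longrightarrow> \<bar>y i - x i\<bar> < e0" "\<And>i. i \<notin> I \<Longrightarrow> y i = x i" for y
  proof -
    have "y i \<in> X i" for i
      using that e(2) xX \<open>\<And>i. i \<in> I \<Longrightarrow> e0 \<le> e i\<close> by (cases "i \<in> I") (auto, fastforce)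
    then show ?thesis using X(3) by auto
  qed
  ultimately show ?thesis using that by blast
qed

text \<open>
  On a small cube all partial derivatives are bounded, by continuity at the centre. Moving from one
  point of the cube to another by changing one coordinate at a time stays inside the cube, and the mean
  value inequality bounds each of these steps.
\<close>

lemma C1_locally_lipschitz:
  fixes h :: "('i \<Rightarrow> real) \<Rightarrow> 'b::real_normed_vector"
  assumes fin: "finite I" and T: "open T" and S: "S = T \<inter> {x. \<forall>i. i \<notin> I \<longrightarrow> x i = 0}"
    and C1: "Ck_on I (Suc 0) S h" and x0: "x0 \<in> S"
  obtains e L where "e > 0" "L \<ge> 0"
    "lipschitz_in_coords I (\<lambda>x. x) {x\<in>S. \<forall>i\<in>I. \<bar>x i - x0 i\<bar> < e} L h"
proof -
  obtain D where D: "\<And>i x. i \<in> I \<Longrightarrow> x \<in> S \<Longrightarrow>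
        ((\<lambda>t. h (x(i := t))) has_vector_derivative D i x) (at (x i))"
    and cont: "\<And>i. i \<in> I \<Longrightarrow> continuous_on S (D i)"
    using C1 by simp metis
  \<comment> \<open>The \<open>i\<close>-th partial derivative exceeds its norm at the centre by at most 1 on some cube.\<close>
  have "\<exists>e>0. \<forall>x. (\<forall>j\<in>I. \<bar>x j - x0 j\<bar> < e) \<longrightarrow> (\<forall>j. j \<notin> I \<longrightarrow> x j = 0) \<longrightarrow>
          x \<in> S \<and> norm (D i x) \<le> norm (D i x0) + 1" if i: "i \<in> I" for i
  proof -
    have "openin (top_of_set S) (S \<inter> D i -` ball (D i x0) 1)"
      using cont[OF i] by (intro continuous_openin_preimage_gen) auto
    then obtain U where U: "open U" "S \<inter> D i -` ball (D i x0) 1 = S \<inter> U"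
      by (auto simp: openin_open)
    have "x0 \<in> T \<inter> U" using x0 S U(2) by auto
    then obtain e where e: "e > 0" "\<And>y. \<lbrakk>\<And>i. i \<in> I \<Longrightarrow> \<bar>y i - x0 i\<bar> < e; \<And>i. i \<notin> I \<Longrightarrow> y i = x0 i\<rbrakk>
        \<Longrightarrow> y \<in> T \<inter> U"
      using cube_in_open_fun[of "T \<inter> U" x0 I] T U(1) fin by (metis open_Int)
    have "x \<in> S \<and> norm (D i x) \<le> norm (D i x0) + 1"
      if "\<forall>j\<in>I. \<bar>x j - x0 j\<bar> < e" "\<forall>j. j \<notin> I \<longrightarrow> x j = 0" for x
    proof -
      have "x \<in> T \<inter> U" using that x0 S by (intro e(2)) auto
      then have "x \<in> S" "x \<in> U" using that S by auto
      then have "D i x \<in> ball (D i x0) 1" using U(2) by blast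
      then have "norm (D i x) \<le> norm (D i x0) + 1"
        using norm_triangle_sub[of "D i x" "D i x0"] by (simp add: dist_norm norm_minus_commute)
      then show ?thesis using \<open>x \<in> S\<close> by simp
    qed
    then show ?thesis using e(1) by blast
  qed
  then obtain e where e: "\<And>i. i \<in> I \<Longrightarrow> e i > 0"
    "\<And>i x. \<lbrakk>i \<in> I; \<forall>j\<in>I. \<bar>x j - x0 j\<bar> < e i; \<forall>j. j \<notin> I \<longrightarrow> x j = 0\<rbrakk> \<Longrightarrow>
          x \<in> S \<and> norm (D i x) \<le> norm (D i x0) + 1"
    by metis
  \<comment> \<open>The 1 provides a radius when \<open>I\<close> is empty.\<close>
  define e0 where "e0 = Min (insert 1 (e ` I))"
  have e0: "e0 > 0" "\<And>i. i \<in> I \<Longrightarrow> e0 \<le> e i"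
    using fin e(1) by (auto simp: e0_def)
  define L where "L = (\<Sum>i\<in>I. norm (D i x0) + 1)"
  define Q where "Q = {x. (\<forall>j\<in>I. \<bar>x j - x0 j\<bar> < e0) \<and> (\<forall>j. j \<notin> I \<longrightarrow> x j = 0)}"
  have Q: "x \<in> S" "norm (D i x) \<le> norm (D i x0) + 1" if "i \<in> I" "x \<in> Q" for i x
    using e(2)[OF that(1), of x] e0(2)[OF that(1)] that(2) unfolding Q_def by fastforce+
  have step: "norm (h (x(i := t)) - h x) \<le> (norm (D i x0) + 1) * \<bar>t - x i\<bar>"
    if i: "i \<in> I" and x: "x \<in> Q" and xt: "x(i := t) \<in> Q" for i x t
  proof -
    have inQ: "x(i := u) \<in> Q" if u: "u \<in> closed_segment (x i) t" for u
    proof -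
      have "x i \<in> ball (x0 i) e0" "t \<in> ball (x0 i) e0"
        using i x xt by (auto simp: Q_def dist_real_def abs_minus_commute)
      then have "u \<in> ball (x0 i) e0"
        using u convex_ball closed_segment_subset by blast
      then have "\<bar>u - x0 i\<bar> < e0" by (simp add: dist_real_def abs_minus_commute)
      then show ?thesis using x i unfolding Q_def by auto
    qed
    have der: "((\<lambda>u. h (x(i := u))) has_derivative (\<lambda>v. v *\<^sub>R D i (x(i := u))))
        (at u within closed_segment (x i) t)"
      if u: "u \<in> closed_segment (x i) t" for u
      using D[OF i Q(1)[OF i inQ[OF u]]]
      by (auto simp: has_vector_derivative_def intro: has_derivative_at_withinI)
    have "norm (h (x(i := t)) - h (x(i := x i))) \<le> (norm (D i x0) + 1) * norm (t - x i)"
    proof (rule differentiable_bound[OF convex_closed_segment der])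
      fix u assume u: "u \<in> closed_segment (x i) t"
      show "onorm (\<lambda>v. v *\<^sub>R D i (x(i := u))) \<le> norm (D i x0) + 1"
        using Q(2)[OF i inQ[OF u]] by (intro onorm_le) (simp add: mult.commute mult_left_mono)
    qed auto
    then show ?thesis by simp
  qed
  have "norm (h y - h z) \<le> L * d"
    if y: "y \<in> Q" and z: "z \<in> Q" and d: "\<And>i. i \<in> I \<Longrightarrow> \<bar>y i - z i\<bar> \<le> d" for y z d
  proof -
    \<comment> \<open>The coordinates in \<open>J\<close> have already been moved from \<open>z\<close> to \<open>y\<close>.\<close>
    have "norm (h (override_on z y J) - h z) \<le> (\<Sum>i\<in>J. norm (D i x0) + 1) * d"
      if "finite J" "J \<subseteq> I" for J
      using that
    proof (induction J)
      case empty then show ?case by simp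
    next
      case (insert i J)
      let ?w = "override_on z y J"
      have w: "override_on z y (insert i J) = ?w(i := y i)" "?w i = z i"
        using insert by (auto simp: override_on_def)
      have wQ: "override_on z y J' \<in> Q" for J'
        using y z by (auto simp: Q_def override_on_def)
      have "norm (h (?w(i := y i)) - h ?w) \<le> (norm (D i x0) + 1) * \<bar>y i - ?w i\<bar>"
        using insert wQ w(1) by (intro step) (auto simp flip: w(1))
      also have "\<dots> \<le> (norm (D i x0) + 1) * d"
        using d[of i] insert w(2) by (intro mult_left_mono) auto
      finally have "norm (h (?w(i := y i)) - h ?w) \<le> (norm (D i x0) + 1) * d" .
      then have "norm (h (?w(i := y i)) - h z)
          \<le> (norm (D i x0) + 1) * d + (\<Sum>i\<in>J. norm (D i x0) + 1) * d"
        using insert norm_diff_triangle_le[of "h (?w(i := y i))" "h ?w" _ "h z"] by auto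
      also have "\<dots> = (\<Sum>i\<in>insert i J. norm (D i x0) + 1) * d"
        using insert.hyps by (simp add: distrib_right)
      finally show ?case by (simp only: w(1))
    qed
    from this[of I] fin have "norm (h (override_on z y I) - h z) \<le> L * d"
      by (simp add: L_def)
    moreover have "override_on z y I = y"
      using y z by (auto simp: override_on_def Q_def)
    ultimately show ?thesis by simp
  qed
  then have "lipschitz_in_coords I (\<lambda>x. x) {x\<in>S. \<forall>i\<in>I. \<bar>x i - x0 i\<bar> < e0} L h"
    unfolding lipschitz_in_coords_def Q_def using S by blast
  moreover have "L \<ge> 0" unfolding L_def by (intro sum_nonneg) auto
  ultimately show ?thesis using that e0(1) by blast
qed

lemma lipschitz_in_coords_mono:
  "lipschitz_in_coords I c N L u \<Longrightarrow> L \<le> L' \<Longrightarrow> lipschitz_in_coords I c N L' u"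
  unfolding lipschitz_in_coords_def by (meson mult_right_mono order_trans)

text \<open>
  The composition \<open>g \<circ> f\<close> is handled at the level of Lipschitz constants: they multiply, once the neighbourhood is so small that \<open>f\<close> maps it into a cube on which \<open>g\<close> is
  Lipschitz.
\<close>

lemma lipschitz_chart_neighbourhood:
  fixes f :: "'a \<Rightarrow> real^'m" and g :: "real^'m \<Rightarrow> real^'l"
  assumes r: "1 \<le> r" and mfd: "Cr_manifold r n X \<A>" and V: "open V"
    and fV: "f ` topspace X \<subseteq> V" and f: "Cr_map r n \<A> f" and g: "Cr_on_vec r V g"
    and a: "a \<in> topspace X"
  obtains N \<phi> M L where "openin X N" "a \<in> N" "\<forall>x\<in>N. \<forall>j<n. \<bar>\<phi> x j\<bar> \<le> M"
    "lipschitz_in_coords {..<n} \<phi> N L f" "lipschitz_in_coords {..<n} \<phi> N L (g \<circ> f)"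
    "M \<ge> 0" "L \<ge> 0"
proof -
  have r1: "enat (Suc 0) \<le> r" using r by (simp add: one_enat_def)
  obtain U \<phi> where U: "(U, \<phi>) \<in> \<A>" "a \<in> U" and chart: "chart_on n X U \<phi>"
    using mfd a unfolding Cr_manifold_def by blast
  have opU: "openin X U" and op: "openin (Euclidean_space n) (\<phi> ` U)"
    and homeo: "homeomorphic_map (subtopology X U) (subtopology (Euclidean_space n) (\<phi> ` U)) \<phi>"
    using chart by (auto simp: chart_on_def)
  have topU: "topspace (subtopology X U) = U"
    using openin_subset[OF opU] by auto
  have inj: "inj_on \<phi> U"
    using homeomorphic_imp_injective_map[OF homeo] topU by simp
  obtain T where T: "open T" "\<phi> ` U = T \<inter> {x. \<forall>i\<ge>n. x i = 0}"
    using op unfolding Euclidean_space_def openin_subtopology euclidean_product_topology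
    by auto
  have Ckf: "Ck_on {..<n} (Suc 0) (\<phi> ` U) (\<lambda>x. f (inv_into U \<phi> x))"
    using f U(1) r1 unfolding Cr_map_def Cr_on_def by blast
  have \<phi>U: "\<phi> ` U = T \<inter> {x. \<forall>i. i \<notin> {..<n} \<longrightarrow> x i = 0}" using T(2) by (simp add: not_less)
  obtain e1 L1 where e1: "e1 > 0" "L1 \<ge> 0"
    and lip1: "lipschitz_in_coords {..<n} (\<lambda>x. x)
      {x\<in>\<phi> ` U. \<forall>i\<in>{..<n}. \<bar>x i - \<phi> a i\<bar> < e1} L1 (\<lambda>x. f (inv_into U \<phi> x))"
    using C1_locally_lipschitz[OF finite_lessThan T(1) \<phi>U Ckf imageI[OF U(2)]] .
  have Veq: "vec_nth ` V = vec_lambda -` V"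
    by (auto simp: image_iff vec_lambda_inverse) (metis vec_lambda_inverse UNIV_I)
  have "open (vec_lambda -` V :: ('m \<Rightarrow> real) set)"
    using V by (intro open_vimage continuous_on_vec_lambda continuous_intros) auto
  then have opV: "open (vec_nth ` V)" unfolding Veq .
  have Ckg: "Ck_on UNIV (Suc 0) (vec_nth ` V) (\<lambda>x. g (vec_lambda x))"
    using g r1 unfolding Cr_on_vec_def Cr_on_def by blast
  have VI: "vec_nth ` V = vec_nth ` V \<inter> {x. \<forall>i. i \<notin> UNIV \<longrightarrow> x i = 0}" by simp
  have "f a \<in> V" using fV a by blast
  obtain e2 L2 where e2: "e2 > 0" "L2 \<ge> 0"
    and lip2: "lipschitz_in_coords UNIV (\<lambda>x. x)
      {x\<in>vec_nth ` V. \<forall>i\<in>UNIV. \<bar>x i - f a $ i\<bar> < e2} L2 (\<lambda>x. g (vec_lambda x))"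
    using C1_locally_lipschitz[OF finite opV VI Ckg imageI[OF \<open>f a \<in> V\<close>]] .
  \<comment> \<open>Radius at most 1 bounds the coordinates, at most \<open>e1\<close> keeps inside the cube where \<open>f\<close> is
    Lipschitz, and \<open>e2 / (L1 + 1)\<close> makes \<open>f\<close> move by less than \<open>e2\<close>, where \<open>g\<close> is Lipschitz.\<close>
  define e where "e = min 1 (min e1 (e2 / (L1 + 1)))"
  have e: "e > 0" "e \<le> 1" "e \<le> e1" using e1 e2 by (auto simp: e_def)
  have "L1 * e \<le> L1 * (e2 / (L1 + 1))"
    using e1 by (intro mult_left_mono) (auto simp: e_def)
  also have "\<dots> < e2" using e1 e2 by (simp add: field_simps)
  finally have L1e: "L1 * e < e2" .
  define N where "N = {z\<in>U. \<forall>j<n. \<bar>\<phi> z j - \<phi> a j\<bar> < e}"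
  have lipf: "lipschitz_in_coords {..<n} \<phi> N L1 f"
    unfolding lipschitz_in_coords_def
  proof (intro ballI allI impI)
    fix x y d assume *: "x \<in> N" "y \<in> N" "0 \<le> d" "\<forall>j\<in>{..<n}. \<bar>\<phi> x j - \<phi> y j\<bar> \<le> d"
    have "norm (f (inv_into U \<phi> (\<phi> x)) - f (inv_into U \<phi> (\<phi> y))) \<le> L1 * d"
      using * e(3) by (intro lipschitz_in_coordsD[OF lip1]) (fastforce simp: N_def)+
    then show "norm (f x - f y) \<le> L1 * d"
      using * inj by (simp add: N_def)
  qed
  have aN: "a \<in> N" using U(2) e by (simp add: N_def)
  have near: "\<bar>f x $ i - f a $ i\<bar> < e2" if "x \<in> N" for x i
  proof -
    have "norm (f x - f a) \<le> L1 * e"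
      using that aN e by (intro lipschitz_in_coordsD[OF lipf]) (auto simp: N_def less_imp_le)
    then show ?thesis using component_le_norm_cart[of "f x - f a" i] L1e by simp
  qed
  have NX: "N \<subseteq> topspace X" using openin_subset[OF opU] by (auto simp: N_def)
  have lipgf: "lipschitz_in_coords {..<n} \<phi> N (L2 * L1) (g \<circ> f)"
    unfolding lipschitz_in_coords_def
  proof (intro ballI allI impI)
    fix x y d assume *: "x \<in> N" "y \<in> N" "0 \<le> d" "\<forall>j\<in>{..<n}. \<bar>\<phi> x j - \<phi> y j\<bar> \<le> d"
    have fxy: "norm (f x - f y) \<le> L1 * d"
      using * by (intro lipschitz_in_coordsD[OF lipf]) auto
    have "\<bar>f x $ i - f y $ i\<bar> \<le> L1 * d" for i
      using component_le_norm_cart[of "f x - f y" i] fxy by simp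
    moreover have "f x \<in> V" "f y \<in> V" using * NX fV by auto
    ultimately have "norm (g (vec_lambda (vec_nth (f x))) - g (vec_lambda (vec_nth (f y)))) \<le> L2 * (L1 * d)"
      using * near e1 by (intro lipschitz_in_coordsD[OF lip2]) auto
    then show "norm ((g \<circ> f) x - (g \<circ> f) y) \<le> L2 * L1 * d"
      by (simp add: vec_nth_inverse mult.assoc)
  qed
  have "openin X N"
  proof -
    have "continuous_map (subtopology X U) euclideanreal (\<lambda>z. \<phi> z j)" for j
    proof -
      have "continuous_map (subtopology X U) (powertop_real UNIV) \<phi>"
        by (rule continuous_map_into_fulltopology[OF continuous_map_into_fulltopology
              [OF homeomorphic_imp_continuous_map[OF homeo[unfolded Euclidean_space_def]]]])
      then show ?thesis by (simp add: continuous_map_componentwise_UNIV)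
    qed
    then have "openin (subtopology X U) {z\<in>topspace (subtopology X U). \<phi> z j \<in> ball (\<phi> a j) e}" for j
      by (rule openin_continuous_map_preimage) simp
    then have "openin (subtopology X U) {z\<in>U. \<phi> z j \<in> ball (\<phi> a j) e}" for j
      unfolding topU .
    then have "openin X {z\<in>U. \<bar>\<phi> z j - \<phi> a j\<bar> < e}" for j
      using opU by (simp add: openin_open_subtopology dist_real_def abs_minus_commute)
    then have "openin X (U \<inter> (\<Inter>j\<in>{..<n}. {z\<in>U. \<bar>\<phi> z j - \<phi> a j\<bar> < e}))"
      using opU by (cases "n = 0") (auto intro!: openin_Int openin_INT2)
    also have "U \<inter> (\<Inter>j\<in>{..<n}. {z\<in>U. \<bar>\<phi> z j - \<phi> a j\<bar> < e}) = N"
      by (auto simp: N_def)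
    finally show ?thesis .
  qed
  moreover have "\<bar>\<phi> x j\<bar> \<le> (\<Sum>j<n. \<bar>\<phi> a j\<bar>) + 1" if "x \<in> N" "j < n" for x j
  proof -
    have "\<bar>\<phi> a j\<bar> \<le> (\<Sum>j<n. \<bar>\<phi> a j\<bar>)"
      using that by (intro member_le_sum) auto
    moreover have "\<bar>\<phi> x j - \<phi> a j\<bar> < 1" using that e(2) by (fastforce simp: N_def)
    ultimately show ?thesis by linarith
  qed
  moreover have "(\<Sum>j<n. \<bar>\<phi> a j\<bar>) + 1 \<ge> 0" by (simp add: sum_nonneg add_nonneg_nonneg)
  ultimately show ?thesis
    using that[of N \<phi> "(\<Sum>j<n. \<bar>\<phi> a j\<bar>) + 1" "max L1 (L2 * L1)"] aN e1(2)
      lipschitz_in_coords_mono[OF lipf, of "max L1 (L2 * L1)"]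
      lipschitz_in_coords_mono[OF lipgf, of "max L1 (L2 * L1)"] by simp
qed

section \<open>Matrices that identify two points\<close>

lemma norm_matrix_le:
  fixes A :: "real^'m^'l"
  assumes "\<And>p q. \<bar>A $ p $ q\<bar> \<le> K"
  shows "norm A \<le> real CARD('l) * (real CARD('m) * K)"
proof -
  have row: "norm (A $ p) \<le> real CARD('m) * K" for p
    using norm_le_l1_cart[of "A $ p"] sum_bounded_above[of UNIV "\<lambda>q. \<bar>A $ p $ q\<bar>" K] assms by simp
  have "norm A \<le> (\<Sum>p\<in>UNIV. norm (A $ p))"
    unfolding norm_vec_def by (rule L2_set_le_sum) simp
  also have "\<dots> \<le> real CARD('l) * (real CARD('m) * K)"
    using sum_bounded_above[of UNIV "\<lambda>p. norm (A $ p)" "real CARD('m) * K"] row by simp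
  finally show ?thesis .
qed

text \<open>
  From \<open>(A - A') v = (u - u') - A' (v - v')\<close> the column \<open>i\<close> of \<open>A - A'\<close>, multiplied by \<open>v\<^sub>i\<close>, is
  a combination of small quantities: the differences of the right-hand sides and of the vectors, and
  the other columns of \<open>A - A'\<close>. Dividing by \<open>v\<^sub>i\<close> is harmless as long as \<open>\<bar>v\<^sub>i\<bar>\<close> stays away from
  zero.
\<close>

lemma matrix_column_lipschitz:
  fixes A A' :: "real^'m^'l" and v v' :: "real^'m" and u u' :: "real^'l"
  assumes A: "A *v v = u" and A': "A' *v v' = u'"
    and bA: "\<And>p q. \<bar>A' $ p $ q\<bar> \<le> k" and bv: "\<And>q. \<bar>v $ q\<bar> \<le> k"
    and vi: "\<delta> \<le> \<bar>v $ i\<bar>" and "\<delta> > 0"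
    and du: "norm (u - u') \<le> E" and dv: "norm (v - v') \<le> E" and k: "k \<ge> 0"
    and off: "\<And>p q. q \<noteq> i \<Longrightarrow> \<bar>A $ p $ q - A' $ p $ q\<bar> \<le> d" and d: "d \<ge> 0"
  shows "\<bar>A $ p $ i - A' $ p $ i\<bar> \<le> (E + real CARD('m) * (k * E) + real CARD('m) * (k * d)) / \<delta>"
proof -
  let ?m = "real CARD('m)"
  have E: "E \<ge> 0" using dv norm_ge_zero order_trans by blast
  have "(A - A') *v v = (u - u') - A' *v (v - v')"
    using A A' by (simp add: matrix_vector_mult_diff_rdistrib matrix_vector_mult_diff_distrib)
  then have "((A - A') *v v) $ p = (u - u') $ p - (A' *v (v - v')) $ p"
    by (metis vector_minus_component)
  moreover have "((A - A') *v v) $ p = (\<Sum>q\<in>UNIV. (A - A') $ p $ q * v $ q)"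
    by (simp add: matrix_vector_mult_def)
  moreover have "(\<Sum>q\<in>UNIV. (A - A') $ p $ q * v $ q)
      = (A - A') $ p $ i * v $ i + (\<Sum>q\<in>UNIV-{i}. (A - A') $ p $ q * v $ q)"
    by (rule sum.remove) auto
  ultimately have eq: "(A - A') $ p $ i * v $ i
      = (u - u') $ p - (A' *v (v - v')) $ p - (\<Sum>q\<in>UNIV-{i}. (A - A') $ p $ q * v $ q)"
    by linarith
  have 1: "\<bar>(u - u') $ p\<bar> \<le> E" using component_le_norm_cart du order_trans by blast
  have 2: "\<bar>(A' *v (v - v')) $ p\<bar> \<le> ?m * (k * E)"
  proof -
    have "\<bar>(A' *v (v - v')) $ p\<bar> \<le> (\<Sum>q\<in>UNIV. \<bar>A' $ p $ q * (v - v') $ q\<bar>)"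
      unfolding matrix_vector_mult_def by (simp add: sum_abs)
    also have "\<dots> \<le> ?m * (k * E)"
    proof (rule sum_bounded_above)
      fix q
      have "\<bar>(v - v') $ q\<bar> \<le> E" using component_le_norm_cart dv order_trans by blast
      then show "\<bar>A' $ p $ q * (v - v') $ q\<bar> \<le> k * E"
        unfolding abs_mult using bA k by (intro mult_mono) auto
    qed
    finally show ?thesis .
  qed
  have 3: "\<bar>\<Sum>q\<in>UNIV-{i}. (A - A') $ p $ q * v $ q\<bar> \<le> ?m * (k * d)"
  proof -
    have "\<bar>\<Sum>q\<in>UNIV-{i}. (A - A') $ p $ q * v $ q\<bar> \<le> (\<Sum>q\<in>UNIV-{i}. \<bar>(A - A') $ p $ q * v $ q\<bar>)"
      by (rule sum_abs)
    also have "\<dots> \<le> real (card (UNIV-{i})) * (k * d)"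
    proof (rule sum_bounded_above)
      fix q assume "q \<in> UNIV - {i}"
      then have "\<bar>(A - A') $ p $ q\<bar> * \<bar>v $ q\<bar> \<le> d * k"
        using off bv d by (intro mult_mono) auto
      then show "\<bar>(A - A') $ p $ q * v $ q\<bar> \<le> k * d"
        by (simp add: abs_mult mult.commute)
    qed
    also have "\<dots> \<le> ?m * (k * d)"
      using k d by (intro mult_right_mono) (auto intro: card_mono)
    finally show ?thesis .
  qed
  have "\<bar>(A - A') $ p $ i\<bar> * \<delta> \<le> \<bar>(A - A') $ p $ i * v $ i\<bar>"
    unfolding abs_mult using vi by (intro mult_left_mono) auto
  also have "\<dots> \<le> E + ?m * (k * E) + ?m * (k * d)"
    unfolding eq using 1 2 3 by linarith
  finally show ?thesis using \<open>\<delta> > 0\<close> by (simp add: field_simps)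
qed

text \<open>
  The critical dimension \<open>\<ell> (m - 1) + 2 n\<close> is nonnegative because \<open>m \<ge> 1\<close>.
\<close>

lemma collision_dimension_pos:
  assumes "s > real CARD('m::finite) * real CARD('l::finite) + 2 * real n - real CARD('l)"
  shows "s > 0"
proof -
  have "1 * real CARD('l) \<le> real CARD('m) * real CARD('l)"
    by (intro mult_right_mono) (simp_all add: Suc_leI)
  then show ?thesis using assms by linarith
qed

text \<open>
  One piece of the decomposition: the two points lie in given coordinate neighbourhoods, all relevant
  quantities are bounded, and component \<open>i\<close> of \<open>f x - f y\<close> stays away from zero. A matrix of this
  piece may belong to several pairs \<open>(x, y)\<close>; one pair is chosen for each matrix, and its coordinates
  together with the entries outside column \<open>i\<close> serve as the parameters of the matrix. Because column
  \<open>i\<close> is omitted, their number is \<open>2 n + \<ell> (m - 1)\<close>.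
\<close>

lemma hausdorff_null_collision_matrices:
  fixes f :: "'a \<Rightarrow> real^'m" and h :: "'a \<Rightarrow> real^'l" and \<phi> \<psi> :: "'a \<Rightarrow> nat \<Rightarrow> real"
  assumes s: "s > real CARD('m) * real CARD('l) + 2 * real n - real CARD('l)"
    and N: "\<And>x j. x \<in> N \<Longrightarrow> j < n \<Longrightarrow> \<bar>\<phi> x j\<bar> \<le> M"
      "lipschitz_in_coords {..<n} \<phi> N L f" "lipschitz_in_coords {..<n} \<phi> N L h"
    and N': "\<And>x j. x \<in> N' \<Longrightarrow> j < n \<Longrightarrow> \<bar>\<psi> x j\<bar> \<le> M"
      "lipschitz_in_coords {..<n} \<psi> N' L f" "lipschitz_in_coords {..<n} \<psi> N' L h"
    and L: "L \<ge> 0" and M: "M \<ge> 0" and \<delta>: "\<delta> > 0"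
  shows "hausdorff_outer_measure s
    {A :: real^'m^'l. \<exists>x\<in>N. \<exists>y\<in>N'. A *v (f x - f y) = h y - h x \<and>
       (\<forall>p q. \<bar>A $ p $ q\<bar> \<le> k) \<and> (\<forall>q. \<bar>(f x - f y) $ q\<bar> \<le> k) \<and> \<delta> \<le> \<bar>(f x - f y) $ i\<bar>} = 0"
    (is "hausdorff_outer_measure s ?B = 0")
proof (cases "k \<ge> 0")
  case k: True
  define Q where "Q A x y \<longleftrightarrow> x \<in> N \<and> y \<in> N' \<and> A *v (f x - f y) = h y - h x \<and>
       (\<forall>p q. \<bar>A $ p $ q\<bar> \<le> k) \<and> (\<forall>q. \<bar>(f x - f y) $ q\<bar> \<le> k) \<and> \<delta> \<le> \<bar>(f x - f y) $ i\<bar>"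
    for A x y
  have B: "?B = {A. \<exists>x y. Q A x y}" unfolding Q_def by (simp only: Bex_def ex_simps conj_assoc)
  define X where "X A = (SOME x. \<exists>y. Q A x y)" for A
  define Y where "Y A = (SOME y. Q A (X A) y)" for A
  have Q: "Q A (X A) (Y A)" if "A \<in> ?B" for A
  proof -
    have "\<exists>x y. Q A x y" using that unfolding B mem_Collect_eq .
    then have "\<exists>y. Q A (X A) y" unfolding X_def by (rule someI_ex)
    then show ?thesis unfolding Y_def by (rule someI_ex)
  qed
  note XY = Q[unfolded Q_def]
  define I :: "((nat + nat) + 'l \<times> 'm) set" where "I = ({..<n} <+> {..<n}) <+> (UNIV \<times> (UNIV - {i}))"
  define c :: "real^'m^'l \<Rightarrow> (nat + nat) + 'l \<times> 'm \<Rightarrow> real" where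
    "c A = case_sum (case_sum (\<phi> (X A)) (\<psi> (Y A))) (\<lambda>(p, q). A $ p $ q)" for A
  have finI: "finite I" by (simp add: I_def)
  have "card I = n + n + CARD('l) * (CARD('m) - 1)"
    unfolding I_def by (subst card_Plus; simp add: card_Plus card_cartesian_product card_Diff_singleton)
  moreover obtain m' where "CARD('m) = Suc m'"
    using zero_less_card_finite gr0_conv_Suc by blast
  ultimately have sI: "s > real (card I)"
    using s by (simp add: algebra_simps)
  let ?m = "real CARD('m)" and ?l = "real CARD('l)"
  define K where "K = (2 * L + ?m * (k * (2 * L)) + ?m * k) / \<delta>"
  have K: "K \<ge> 0" using L k \<delta> by (simp add: K_def)
  have lip: "lipschitz_in_coords I c ?B (?l * (?m * (K + 1))) (\<lambda>A. A)"
    unfolding lipschitz_in_coords_def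
  proof (intro ballI allI impI)
    fix A A' d assume A: "A \<in> ?B" and A': "A' \<in> ?B" and d: "0 \<le> d"
      and close: "\<forall>j\<in>I. \<bar>c A j - c A' j\<bar> \<le> d"
    note xA = XY[OF A] and xA' = XY[OF A']
    have cX: "\<bar>\<phi> (X A) j - \<phi> (X A') j\<bar> \<le> d" if "j \<in> {..<n}" for j
      using close[rule_format, of "Inl (Inl j)"] that by (simp add: c_def I_def Plus_def image_iff)
    have cY: "\<bar>\<psi> (Y A) j - \<psi> (Y A') j\<bar> \<le> d" if "j \<in> {..<n}" for j
      using close[rule_format, of "Inl (Inr j)"] that by (simp add: c_def I_def Plus_def image_iff)
    have off: "\<bar>A $ p $ q - A' $ p $ q\<bar> \<le> d" if "q \<noteq> i" for p q
      using close[rule_format, of "Inr (p, q)"] that by (simp add: c_def I_def Plus_def image_iff)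
    have fX: "norm (f (X A) - f (X A')) \<le> L * d" and hX: "norm (h (X A) - h (X A')) \<le> L * d"
      using lipschitz_in_coordsD[OF N(2) _ _ d cX] lipschitz_in_coordsD[OF N(3) _ _ d cX] xA xA'
      by auto
    have fY: "norm (f (Y A) - f (Y A')) \<le> L * d" and hY: "norm (h (Y A) - h (Y A')) \<le> L * d"
      using lipschitz_in_coordsD[OF N'(2) _ _ d cY] lipschitz_in_coordsD[OF N'(3) _ _ d cY] xA xA'
      by auto
    have dv: "norm ((f (X A) - f (Y A)) - (f (X A') - f (Y A'))) \<le> 2 * L * d"
      using norm_diff_triangle_ineq[of "f (X A)" "f (Y A')" "f (X A')" "f (Y A)"] fX fY
        norm_triangle_ineq4[of "f (X A) - f (X A')" "f (Y A) - f (Y A')"]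
      by (simp add: algebra_simps)
    have du: "norm ((h (Y A) - h (X A)) - (h (Y A') - h (X A'))) \<le> 2 * L * d"
      using hX hY norm_triangle_ineq4[of "h (Y A) - h (Y A')" "h (X A) - h (X A')"]
      by (simp add: algebra_simps)
    have "\<bar>A $ p $ i - A' $ p $ i\<bar> \<le> (2 * L * d + ?m * (k * (2 * L * d)) + ?m * (k * d)) / \<delta>" for p
      using xA xA' \<delta> du dv k off d
      by (intro matrix_column_lipschitz[where v = "f (X A) - f (Y A)" and v' = "f (X A') - f (Y A')"
            and u = "h (Y A) - h (X A)" and u' = "h (Y A') - h (X A')"]) auto
    also have "(2 * L * d + ?m * (k * (2 * L * d)) + ?m * (k * d)) / \<delta> = K * d"
      by (simp add: K_def algebra_simps)
    finally have col: "\<bar>A $ p $ i - A' $ p $ i\<bar> \<le> K * d" for p .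
    have "\<bar>(A - A') $ p $ q\<bar> \<le> (K + 1) * d" for p q
      using col[of p] off[of q p] d K mult_nonneg_nonneg[OF K d]
      by (cases "q = i") (auto simp: algebra_simps)
    then have "norm (A - A') \<le> ?l * (?m * ((K + 1) * d))" by (rule norm_matrix_le)
    then show "norm (A - A') \<le> ?l * (?m * (K + 1)) * d" by (simp add: mult.assoc)
  qed
  show ?thesis
  proof (rule hausdorff_null_if_lipschitz_in_coords[OF finI sI _ lip])
    fix A j assume A: "A \<in> ?B" and j: "j \<in> I"
    show "\<bar>c A j\<bar> \<le> max M k"
      using XY[OF A] j N(1) N'(1) unfolding I_def
      by (auto simp: c_def le_max_iff_disj)
  qed (use K M in auto)
next
  case False
  then have B: "?B = {}" by (auto simp: not_le)
  show ?thesis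
    unfolding B using hausdorff_null_Union[OF collision_dimension_pos[OF s], of "{}"] by simp
qed

section \<open>The set of all matrices that destroy injectivity\<close>

theorem theorem5p10:
  fixes X :: "'a topology"
    and \<A> :: "('a set \<times> ('a \<Rightarrow> nat \<Rightarrow> real)) set"
    and n :: nat and r :: enat and s :: real
    and V :: "(real^'m) set"
    and f :: "'a \<Rightarrow> real^'m"
    and g :: "real^'m \<Rightarrow> real^'l"
  assumes "1 \<le> r"
    and "Cr_manifold r n X \<A>"
    and "CARD('l) > 2 * n"
    and "open V"
    and "f ` topspace X \<subseteq> V"
    and "inj_on f (topspace X)"
    and "Cr_map r n \<A> f"
    and "Cr_on_vec r V g"
    and "s > real CARD('m) * real CARD('l) + 2 * real n - real CARD('l)"
  shows "hausdorff_null_linear_maps s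
    {\<pi> :: real^'m \<Rightarrow> real^'l. linear \<pi> \<and> \<not> inj_on ((\<lambda>v. g v + \<pi> v) \<circ> f) (topspace X)}"
proof -
  note s0 = collision_dimension_pos[OF assms(9)]
  define good where "good N \<longleftrightarrow> (\<exists>\<phi> M L. (\<forall>x\<in>N. \<forall>j<n. \<bar>\<phi> x j\<bar> \<le> M) \<and>
    lipschitz_in_coords {..<n} \<phi> N L f \<and> lipschitz_in_coords {..<n} \<phi> N L (g \<circ> f) \<and> M \<ge> 0 \<and> L \<ge> 0)"
    for N
  have local: "\<exists>N. openin X N \<and> a \<in> N \<and> good N" if a: "a \<in> topspace X" for a
  proof -
    obtain N \<phi> M L where "openin X N" "a \<in> N" "\<forall>x\<in>N. \<forall>j<n. \<bar>\<phi> x j\<bar> \<le> M"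
      "lipschitz_in_coords {..<n} \<phi> N L f" "lipschitz_in_coords {..<n} \<phi> N L (g \<circ> f)"
      "M \<ge> 0" "L \<ge> 0"
      using lipschitz_chart_neighbourhood[OF assms(1,2,4,5,7,8) a] .
    then show ?thesis unfolding good_def by (intro exI[of _ N]) blast
  qed
  have "second_countable X"
  proof -
    have "second_countable_space X" using assms(2) by (simp add: Cr_manifold_def)
    then obtain \<B> where \<B>: "countable \<B>" "\<forall>B\<in>\<B>. openin X B"
      "\<forall>U. openin X U \<longrightarrow> (\<exists>\<U>\<subseteq>\<B>. U = \<Union>\<U>)"
      unfolding second_countable_space_def by (elim exE conjE)
    have basis: "\<exists>W\<in>\<B>. x \<in> W \<and> W \<subseteq> U" if U: "openin X U" "x \<in> U" for U x
    proof -
      from \<B>(3)[rule_format, OF U(1)]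
      obtain \<U> where \<U>: "\<U> \<subseteq> \<B>" "U = \<Union>\<U>" by (elim exE conjE)
      obtain W where "W \<in> \<U>" "x \<in> W" using \<U>(2) U(2) by blast
      moreover have "W \<subseteq> U" using \<U>(2) \<open>W \<in> \<U>\<close> by (simp add: Union_upper)
      ultimately show ?thesis using \<U>(1) by (intro bexI[of _ W]) auto
    qed
    show ?thesis unfolding second_countable_def
      by (rule exI[of _ \<B>]) (simp add: \<B>(1,2) basis)
  qed
  then have Lin: "Lindelof_space X" by (rule second_countable_imp_Lindelof_space)
  obtain \<N> where \<N>: "countable \<N>" "\<N> \<subseteq> {N. openin X N \<and> good N}" "\<Union>\<N> = topspace X"
  proof -
    have "\<Union>{N. openin X N \<and> good N} = topspace X"
      using local openin_subset by fastforce
    then show ?thesis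
      using Lindelof_spaceD[OF Lin, of "{N. openin X N \<and> good N}"] that by auto
  qed
  \<comment> \<open>A single natural number \<open>k\<close> serves as the bound on \<open>A\<close> and on \<open>v\<close> and, through
    \<open>1 / (k + 1)\<close>, as the lower bound on \<open>\<bar>v $ i\<bar>\<close>; this keeps the family of pieces countable.\<close>
  define P where "P = (\<lambda>(N, N', i, k::nat). {A :: real^'m^'l. \<exists>x\<in>N. \<exists>y\<in>N'.
       A *v (f x - f y) = (g \<circ> f) y - (g \<circ> f) x \<and>
       (\<forall>p q. \<bar>A $ p $ q\<bar> \<le> real k) \<and> (\<forall>q. \<bar>(f x - f y) $ q\<bar> \<le> real k) \<and>
       1 / (real k + 1) \<le> \<bar>(f x - f y) $ i\<bar>})"
  have null: "hausdorff_outer_measure s (P (N, N', i, k)) = 0" if "good N" "good N'" for N N' i k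
  proof -
    obtain \<phi> M L where N: "\<forall>x\<in>N. \<forall>j<n. \<bar>\<phi> x j\<bar> \<le> M" "lipschitz_in_coords {..<n} \<phi> N L f"
        "lipschitz_in_coords {..<n} \<phi> N L (g \<circ> f)" "M \<ge> 0" "L \<ge> 0"
      using \<open>good N\<close> unfolding good_def by blast
    obtain \<psi> M' L' where N': "\<forall>x\<in>N'. \<forall>j<n. \<bar>\<psi> x j\<bar> \<le> M'" "lipschitz_in_coords {..<n} \<psi> N' L' f"
        "lipschitz_in_coords {..<n} \<psi> N' L' (g \<circ> f)" "M' \<ge> 0" "L' \<ge> 0"
      using \<open>good N'\<close> unfolding good_def by blast
    show ?thesis unfolding P_def prod.case
    proof (rule hausdorff_null_collision_matrices[OF assms(9), where \<phi> = \<phi> and \<psi> = \<psi>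
          and h = "g \<circ> f" and L = "max L L'" and M = "max M M'"])
      show "\<bar>\<phi> x j\<bar> \<le> max M M'" if "x \<in> N" "j < n" for x j
        using N(1) that by (simp add: le_max_iff_disj)
      show "\<bar>\<psi> x j\<bar> \<le> max M M'" if "x \<in> N'" "j < n" for x j
        using N'(1) that by (simp add: le_max_iff_disj)
    qed (use N N' in \<open>auto intro: lipschitz_in_coords_mono\<close>)
  qed
  define \<B> where "\<B> = P ` (\<N> \<times> \<N> \<times> UNIV \<times> UNIV)"
  have "countable \<B>" unfolding \<B>_def using \<N>(1) by (intro countable_image countable_SIGMA) auto
  moreover have "hausdorff_outer_measure s B = 0" if "B \<in> \<B>" for B
  proof -
    have "good N" if "N \<in> \<N>" for N using that \<N>(2) by blast
    then show ?thesis using that null unfolding \<B>_def by auto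
  qed
  ultimately have nullU: "hausdorff_outer_measure s (\<Union>\<B>) = 0"
    by (rule hausdorff_null_Union[OF s0])
  have "matrix ` {\<pi> :: real^'m \<Rightarrow> real^'l. linear \<pi> \<and> \<not> inj_on ((\<lambda>v. g v + \<pi> v) \<circ> f) (topspace X)}
      \<subseteq> \<Union>\<B>"
  proof (rule image_subsetI)
    fix \<pi> :: "real^'m \<Rightarrow> real^'l"
    assume "\<pi> \<in> {\<pi>. linear \<pi> \<and> \<not> inj_on ((\<lambda>v. g v + \<pi> v) \<circ> f) (topspace X)}"
    then obtain x y where lin: "linear \<pi>" and xy: "x \<in> topspace X" "y \<in> topspace X" "x \<noteq> y"
      "g (f x) + \<pi> (f x) = g (f y) + \<pi> (f y)"
      by (auto simp: inj_on_def)
    let ?A = "matrix \<pi>" and ?v = "f x - f y"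
    have "?A *v ?v = \<pi> ?v" using lin by (simp add: matrix_works linear_matrix_vector_mul_eq)
    also have "\<dots> = \<pi> (f x) - \<pi> (f y)" using lin by (rule linear_diff)
    also have "\<dots> = (g \<circ> f) y - (g \<circ> f) x" using xy(4) by (simp add: algebra_simps)
    finally have Av: "?A *v ?v = (g \<circ> f) y - (g \<circ> f) x" .
    have "f x \<noteq> f y" using xy assms(6) by (auto dest: inj_onD)
    then obtain i where i: "?v $ i \<noteq> 0" by (auto simp: vec_eq_iff)
    obtain k :: nat where k: "norm ?A + norm ?v + 1 / \<bar>?v $ i\<bar> \<le> real k"
      using real_arch_simple by blast
    have pos: "0 < 1 / \<bar>?v $ i\<bar>" using i by simp
    have "\<bar>?A $ p $ q\<bar> \<le> real k" for p q
    proof -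
      have "\<bar>?A $ p $ q\<bar> \<le> norm (?A $ p)" by (rule component_le_norm_cart)
      also have "\<dots> \<le> norm ?A" by (rule Finite_Cartesian_Product.norm_nth_le)
      finally show ?thesis using k pos norm_ge_zero[of ?v] by linarith
    qed
    moreover have "\<bar>?v $ q\<bar> \<le> real k" for q
      using component_le_norm_cart[of ?v q] k pos norm_ge_zero[of ?A] by linarith
    moreover have "1 / (real k + 1) \<le> \<bar>?v $ i\<bar>"
    proof -
      have "1 / \<bar>?v $ i\<bar> \<le> real k + 1" using k norm_ge_zero[of ?A] norm_ge_zero[of ?v] by linarith
      then show ?thesis using i by (simp add: field_simps)
    qed
    moreover obtain N N' where N: "N \<in> \<N>" "x \<in> N" "N' \<in> \<N>" "y \<in> N'"
      using xy \<N>(3) by blast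
    ultimately have "?A \<in> P (N, N', i, k)"
      unfolding P_def using Av by blast
    then show "?A \<in> \<Union>\<B>" unfolding \<B>_def using N by blast
  qed
  then show ?thesis
    unfolding hausdorff_null_linear_maps_def by (rule hausdorff_null_subset[OF s0 nullU])
qed

end
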